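(* Let $a, b\in\mathbb{N}$ be relatively prime. Consider the following two equations in the unknowns $x, y$: $$\text{(i)}\quad xa+yb = \frac{(a-1)(b-1)}{2},\qquad\qquad \text{(ii)}\quad xa+yb+1 = \frac{(a-1)(b-1)}{2}.$$ Exactly one of the two equations (i), (ii) has a solution $(x,y)$ in nonnegative integers, and for that equation the nonnegative integral solution $(x,y)$ is unique.
   Context: $\mathbb{N}$ denotes the set of positive integers. *)

theory Defs
  imports Complex_Main
begin

text \<open>Both equations are stated over the reals, so that subtraction is not truncated and
  halving is exact; the unknowns are a pair of natural numbers (0 included).\<close>

definition solves_i :: "nat \<Rightarrow> nat \<Rightarrow> nat \<times> nat \<Rightarrow> bool" where
  "solves_i a b = (\<lambda>(x, y).
     real x * real a + real y * real b = (real a - 1) * (real b - 1) / 2)"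

definition solves_ii :: "nat \<Rightarrow> nat \<Rightarrow> nat \<times> nat \<Rightarrow> bool" where
  "solves_ii a b = (\<lambda>(x, y).
     real x * real a + real y * real b + 1 = (real a - 1) * (real b - 1) / 2)"

end

theory Submission
  imports Defs
begin

text \<open>Write \<open>n\<close> and \<open>m\<close> for the two numbers to be represented as \<open>x a + y b\<close>, so that
  \<open>m = n - 1\<close> and \<open>n + m = a b - a - b\<close>. By Sylvester's symmetry, exactly one of two
  integers with this sum is representable: take \<open>n = x a + y b\<close> with
  \<open>0 \<le> x < b\<close>; if \<open>y < 0\<close>, then \<open>m = (b - 1 - x) a + (- 1 - y) b\<close>. A representation is unique
  because \<open>n < a b\<close>.\<close>

lemma solves_i_iff_int:
  "solves_i a b (x, y) \<longleftrightarrow> 2 * (int x * int a + int y * int b) = (int a - 1) * (int b - 1)"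
proof -
  have "solves_i a b (x, y) \<longleftrightarrow>
      real_of_int (2 * (int x * int a + int y * int b)) = real_of_int ((int a - 1) * (int b - 1))"
    unfolding solves_i_def by (simp add: field_simps)
  then show ?thesis by (simp only: of_int_eq_iff)
qed

lemma solves_ii_iff_int:
  "solves_ii a b (x, y) \<longleftrightarrow> 2 * (int x * int a + int y * int b + 1) = (int a - 1) * (int b - 1)"
proof -
  have "solves_ii a b (x, y) \<longleftrightarrow>
      real_of_int (2 * (int x * int a + int y * int b + 1)) = real_of_int ((int a - 1) * (int b - 1))"
    unfolding solves_ii_def by (simp add: field_simps)
  then show ?thesis by (simp only: of_int_eq_iff)
qed

text \<open>Scale a Bezout identity by \<open>n\<close>, then reduce the coefficient of
  \<open>a\<close> modulo \<open>b\<close>; the discarded multiple of \<open>b\<close> is absorbed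
  into the coefficient of \<open>b\<close>.\<close>

lemma bezout_int_reduced:
  fixes a b n :: int
  assumes "b > 0" and "coprime a b"
  obtains x y where "0 \<le> x" "x < b" "n = x * a + y * b"
proof -
  obtain u v where uv: "u * a + v * b = 1"
    using bezout_int[of a b] assms(2) by auto
  have "n = n * (u * a + v * b)"
    by (simp add: uv)
  also have "\<dots> = (n * u) * a + (n * v) * b"
    by (simp add: algebra_simps)
  also have "n * u = (n * u) div b * b + (n * u) mod b"
    by simp
  also have "\<dots> * a + (n * v) * b = (n * u) mod b * a + ((n * u) div b * a + n * v) * b"
    by (simp only: algebra_simps)
  finally show ?thesis
    using that[of "(n * u) mod b"] assms(1) by simp
qed

lemma nonneg_combination_exists:
  fixes a b n m :: int
  assumes "b > 0" and "coprime a b" and "n + m = a * b - a - b"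
  shows "(\<exists>x y. x \<ge> 0 \<and> y \<ge> 0 \<and> n = x * a + y * b) \<or>
         (\<exists>x y. x \<ge> 0 \<and> y \<ge> 0 \<and> m = x * a + y * b)"
proof -
  obtain x y where xy: "0 \<le> x" "x < b" "n = x * a + y * b"
    using bezout_int_reduced[OF assms(1,2)] .
  show ?thesis
  proof (cases "y \<ge> 0")
    case True
    with xy show ?thesis by blast
  next
    case False
    have "m = (b - 1 - x) * a + (- 1 - y) * b"
      using assms(3) xy(3) by (simp add: algebra_simps)
    moreover have "b - 1 - x \<ge> 0" "- 1 - y \<ge> 0"
      using xy False by auto
    ultimately show ?thesis by blast
  qed
qed

text \<open>Equality would make \<open>b\<close> divide \<open>x * a\<close>, hence
  \<open>x\<close>, so \<open>x * a\<close> alone would reach \<open>a * b\<close> and leave no room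
  for \<open>y * b > 0\<close>. This is what keeps (i) and (ii) from both being solvable.\<close>

lemma pos_combination_neq_mult:
  fixes a b x y :: int
  assumes "a > 0" "b > 0" "coprime a b" "x > 0" "y > 0"
  shows "x * a + y * b \<noteq> a * b"
proof
  assume eq: "x * a + y * b = a * b"
  then have "x * a = b * (a - y)"
    by (simp add: algebra_simps)
  then have "b dvd x * a" by simp
  then have "b dvd x"
    using assms(3) by (simp add: coprime_dvd_mult_left_iff coprime_commute)
  then have "b \<le> x"
    using assms(4) by (rule zdvd_imp_le)
  then have "b * a \<le> x * a"
    using assms(1) by simp
  moreover have "y * b > 0"
    using assms by simp
  ultimately show False
    using eq by (simp add: mult.commute)
qed

text \<open>Coprimality makes \<open>x\<close> and \<open>x'\<close> congruent modulo
  \<open>b\<close>, and the bound \<open>a * b\<close> forces both into the range from 0 to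
  \<open>b - 1\<close>.\<close>

lemma nonneg_combination_unique:
  fixes a b x y x' y' :: int
  assumes "a > 0" "b > 0" "coprime a b"
    and nonneg: "x \<ge> 0" "y \<ge> 0" "x' \<ge> 0" "y' \<ge> 0"
    and eq: "x * a + y * b = x' * a + y' * b" and less: "x * a + y * b < a * b"
  shows "x = x'" "y = y'"
proof -
  have bound: "u < b" if "u * a + v * b < a * b" "v \<ge> 0" for u v
  proof -
    have "v * b \<ge> 0" using that assms(2) by simp
    then have "u * a < b * a" using that by (simp add: mult.commute)
    then show ?thesis using assms(1) by simp
  qed
  have "x < b" using bound less nonneg by blast
  moreover have "x' < b" using bound less[unfolded eq] nonneg by blast
  moreover have "b dvd x - x'"
  proof -
    have "(x - x') * a = b * (y' - y)"
      using eq by (simp add: algebra_simps)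
    then have "b dvd (x - x') * a" by simp
    then show ?thesis
      using assms(3) by (simp add: coprime_dvd_mult_left_iff coprime_commute)
  qed
  ultimately show "x = x'"
    using nonneg by (metis mod_eq_dvd_iff mod_pos_pos_trivial)
  with eq assms(2) show "y = y'" by simp
qed

theorem theorem1p1:
  fixes a b :: nat
  assumes "a > 0" and "b > 0" and "coprime a b"
  shows "((\<exists>!p. solves_i a b p) \<and> \<not> (\<exists>p. solves_ii a b p)) \<or>
         (\<not> (\<exists>p. solves_i a b p) \<and> (\<exists>!p. solves_ii a b p))"
proof -
  define A B where "A = int a" and "B = int b"
  have A: "A > 0" and B: "B > 0" and cop: "coprime A B"
    using assms by (auto simp: A_def B_def)
  \<comment> \<open>If both factors were odd, 2 would divide both \<open>A\<close> and
    \<open>B\<close>.\<close>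
  have "even ((A - 1) * (B - 1))"
    using coprime_common_divisor[OF cop, of 2] by auto
  then obtain n where n: "(A - 1) * (B - 1) = 2 * n" by blast
  have sum: "n + (n - 1) = A * B - A - B"
    using n by (simp add: algebra_simps)
  have less: "n < A * B"
  proof -
    \<comment> \<open>So \<open>n \<ge> 0\<close>, whence
      \<open>n \<le> 2 * n = A * B - A - B + 1 < A * B\<close>.\<close>
    have "0 \<le> (A - 1) * (B - 1)" using A B by simp
    then show ?thesis using n sum A B by linarith
  qed
  have i: "solves_i a b (x, y) \<longleftrightarrow> n = int x * A + int y * B" for x y
    using n unfolding solves_i_iff_int A_def B_def by auto
  have ii: "solves_ii a b (x, y) \<longleftrightarrow> n - 1 = int x * A + int y * B" for x y
    using n unfolding solves_ii_iff_int A_def B_def by auto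
  \<comment> \<open>A general \<open>k \<le> n\<close> covers both right-hand sides,
    \<open>n\<close> and \<open>n - 1\<close>.\<close>
  have unique: "p = q"
    if "k = int (fst p) * A + int (snd p) * B" "k = int (fst q) * A + int (snd q) * B" "k \<le> n"
    for k p q
    using nonneg_combination_unique[OF A B cop, of "int (fst p)" "int (snd p)"
        "int (fst q)" "int (snd q)"] that less B
    by (simp add: prod_eq_iff)
  have unique_i: "p = q" if "solves_i a b p" "solves_i a b q" for p q
    using that unique[of n p q] i by (cases p; cases q) simp
  have unique_ii: "p = q" if "solves_ii a b p" "solves_ii a b q" for p q
    using that unique[of "n - 1" p q] ii by (cases p; cases q) simp
  have not_both: False if "solves_i a b p" "solves_ii a b q" for p q
  proof -
    obtain x y x' y' where pq: "p = (x, y)" "q = (x', y')" by fastforce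
    \<comment> \<open>The two representations add up to \<open>A * B - A - B\<close>; moving
      \<open>A\<close> and \<open>B\<close> across raises each coefficient by 1 and so makes it
      positive.\<close>
    have "(int x + int x' + 1) * A + (int y + int y' + 1) * B = A * B"
      using that sum unfolding pq i ii by (simp add: algebra_simps)
    then show False
      using pos_combination_neq_mult[OF A B cop, of "int x + int x' + 1" "int y + int y' + 1"]
      by simp
  qed
  have "(\<exists>p. solves_i a b p) \<or> (\<exists>p. solves_ii a b p)"
    using nonneg_combination_exists[OF B cop sum] i ii by (metis nonneg_int_cases)
  then show ?thesis
    using unique_i unique_ii not_both by blast
qed

end
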